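(* Let $d\in\{2,3\}$, let $c_0,c_1,\Omega,\gamma\in\mathbb{R}$, and let $V$ be the harmonic potential $V(\mathbf{x})=\frac12(\gamma_x^2x^2+\gamma_y^2y^2)$ if $d=2$ and $V(\mathbf{x})=\frac12(\gamma_x^2x^2+\gamma_y^2y^2+\gamma_z^2z^2)$ if $d=3$, with positive trapping frequencies. Suppose that $\Phi_{\rm g}=(\phi_1^{\rm g},\phi_0^{\rm g},\phi_{-1}^{\rm g})^\top\in\mathcal{M}$ is a ground state, i.e. $\mathcal{E}(\Phi_{\rm g})=\min_{\Phi\in\mathcal{M}}\mathcal{E}(\Phi)$. Then $$2\,\mathcal{E}_{\rm kin}(\Phi_{\rm g})-2\,\mathcal{E}_{\rm pot}(\Phi_{\rm g})+d\,\mathcal{E}_{\rm spin}(\Phi_{\rm g})+\mathcal{E}_{\rm soc}(\Phi_{\rm g})=0.$$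
   Context: Points of $\mathbb{R}^d$ are written $\mathbf{x}=(x,y)$ if $d=2$ and $\mathbf{x}=(x,y,z)$ if $d=3$. All wave functions are complex valued. Let $L^2_V(\mathbb{R}^d)=\{\phi : \int_{\mathbb{R}^d}V(\mathbf{x})|\phi(\mathbf{x})|^2\,d\mathbf{x}<\infty\}$. The admissible set is $$\mathcal{M}=\Big\{\Phi=(\phi_1,\phi_0,\phi_{-1})^\top : \phi_j\in H^1(\mathbb{R}^d)\cap L^2_V(\mathbb{R}^d),\ j=-1,0,1,\ \int_{\mathbb{R}^d}\sum_{j=-1}^1|\phi_j|^2\,d\mathbf{x}=1\Big\}.$$ The energy functional (rotating spin-orbit coupled spin-1 Bose-Einstein condensate) is $\mathcal{E}=\mathcal{E}_{\rm kin}+\mathcal{E}_{\rm pot}+\mathcal{E}_{\rm spin}+\mathcal{E}_{\rm rot}+\mathcal{E}_{\rm soc}$, where $$\mathcal{E}_{\rm kin}(\Phi)=\frac12\int_{\mathbb{R}^d}\sum_{\ell=-1}^1|\nabla\phi_\ell|^2\,d\mathbf{x},\qquad \mathcal{E}_{\rm pot}(\Phi)=\int_{\mathbb{R}^d}\sum_{\ell=-1}^1V|\phi_\ell|^2\,d\mathbf{x},$$ $$\mathcal{E}_{\rm spin}(\Phi)=\int_{\mathbb{R}^d}\Big(\frac{c_0}{2}\rho^2+\frac{c_1}{2}|\mathbf{F}|^2\Big)\,d\mathbf{x},\qquad \mathcal{E}_{\rm rot}(\Phi)=-\Omega\int_{\mathbb{R}^d}\sum_{\ell=-1}^1\bar\phi_\ell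 L_z\phi_\ell\,d\mathbf{x},$$ $$\mathcal{E}_{\rm soc}(\Phi)=-\gamma\int_{\mathbb{R}^d}\Phi^\dagger\mathbf{S}\Phi\,d\mathbf{x}.$$ Here - $L_z=-i(x\partial_y-y\partial_x)$; - $\rho=|\phi_1|^2+|\phi_0|^2+|\phi_{-1}|^2$; - $\mathbf{F}=(F_x,F_y,F_z)$ is the real vector with $F_x=\frac{1}{\sqrt2}[\bar\phi_1\phi_0+\bar\phi_0(\phi_1+\phi_{-1})+\bar\phi_{-1}\phi_0]$, $F_y=\frac{i}{\sqrt2}[-\bar\phi_1\phi_0+\bar\phi_0(\phi_1-\phi_{-1})+\bar\phi_{-1}\phi_0]$, $F_z=|\phi_1|^2-|\phi_{-1}|^2$; - $\Phi^\dagger\mathbf{S}\Phi=\bar\phi_1L_0\phi_0+\bar\phi_0(L_0\phi_{-1}+L_1\phi_1)+\bar\phi_{-1}L_1\phi_0$ with $L_0=i\partial_x+\partial_y$ and $L_1=i\partial_x-\partial_y$. All these energies are real, because $L_z$ is symmetric and $L_0,L_1$ are formal adjoints of each other. *)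

theory Defs
  imports "HOL-Analysis.Analysis"
begin

text \<open>Sobolev space \<open>H\<^sup>1\<close> of complex functions on \<open>real ^ 'd\<close>, via weak derivatives. Elements are
  Lebesgue measurable representatives, not classes modulo null sets.\<close>

definition classical_partial :: "'d \<Rightarrow> (real ^ 'd \<Rightarrow> real) \<Rightarrow> real ^ 'd::finite \<Rightarrow> real" where
  "classical_partial i f x = frechet_derivative f (at x) (axis i 1)"

primrec C_k :: "nat \<Rightarrow> (real ^ 'd::finite \<Rightarrow> real) \<Rightarrow> bool" where
  "C_k 0 f \<longleftrightarrow> continuous_on UNIV f"
| "C_k (Suc k) f \<longleftrightarrow> (\<forall>x. f differentiable (at x)) \<and> (\<forall>i. C_k k (classical_partial i f))"

definition test_functions :: "(real ^ 'd::finite \<Rightarrow> real) set" where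
  "test_functions = {\<psi>. (\<forall>k. C_k k \<psi>) \<and> compact (closure {x. \<psi> x \<noteq> 0})}"

definition L2 :: "(real ^ 'd::finite \<Rightarrow> complex) set" where
  "L2 = {\<phi>. \<phi> \<in> borel_measurable lebesgue \<and> integrable lebesgue (\<lambda>x. (cmod (\<phi> x))\<^sup>2)}"

definition has_weak_partial ::
    "'d \<Rightarrow> (real ^ 'd::finite \<Rightarrow> complex) \<Rightarrow> (real ^ 'd \<Rightarrow> complex) \<Rightarrow> bool" where
  "has_weak_partial i \<phi> g \<longleftrightarrow> \<phi> \<in> L2 \<and> g \<in> L2 \<and>
     (\<forall>\<psi>\<in>test_functions.
        (LINT x|lebesgue. \<phi> x * complex_of_real (classical_partial i \<psi> x)) =
        - (LINT x|lebesgue. g x * complex_of_real (\<psi> x)))"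

definition H1 :: "(real ^ 'd::finite \<Rightarrow> complex) set" where
  "H1 = {\<phi>. \<phi> \<in> L2 \<and> (\<forall>i. \<exists>g. has_weak_partial i \<phi> g)}"

text \<open>The weak derivative is unique only up to a null set, so this picks a representative. It is
  used only under integrals, whose values do not depend on the choice.\<close>

definition weak_partial :: "'d \<Rightarrow> (real ^ 'd::finite \<Rightarrow> complex) \<Rightarrow> real ^ 'd \<Rightarrow> complex" where
  "weak_partial i \<phi> = (SOME g. has_weak_partial i \<phi> g)"

definition L2_weighted :: "(real ^ 'd::finite \<Rightarrow> real) \<Rightarrow> (real ^ 'd \<Rightarrow> complex) set" where
  "L2_weighted V = {\<phi>. integrable lebesgue (\<lambda>x. V x * (cmod (\<phi> x))\<^sup>2)}"

text \<open>A spinor has components indexed by \<open>-1, 0, 1\<close>; its values at other integers are never used.\<close>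

type_synonym 'd spinor = "int \<Rightarrow> real ^ 'd \<Rightarrow> complex"

definition density :: "'d::finite spinor \<Rightarrow> real ^ 'd \<Rightarrow> real" where
  "density \<Phi> x = (\<Sum>l\<in>{-1..1}. (cmod (\<Phi> l x))\<^sup>2)"

definition admissible :: "(real ^ 'd::finite \<Rightarrow> real) \<Rightarrow> 'd spinor set" where
  "admissible V = {\<Phi>. (\<forall>j\<in>{-1..1}. \<Phi> j \<in> H1 \<inter> L2_weighted V) \<and>
                       (LINT x|lebesgue. density \<Phi> x) = 1}"

definition harmonic_potential :: "real ^ 'd::finite \<Rightarrow> real ^ 'd \<Rightarrow> real" where
  "harmonic_potential \<omega> x = 1 / 2 * (\<Sum>i\<in>UNIV. (\<omega> $ i)\<^sup>2 * (x $ i)\<^sup>2)"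

text \<open>In \<open>real ^ 2\<close> and \<open>real ^ 3\<close> the coordinates \<open>x, y\<close> have indices \<open>1, 2\<close>; the sort constraint
  \<open>numeral\<close> on the index type only serves to write these indices once for both dimensions.\<close>

definition L_z :: "(real ^ 'd::{finite,numeral} \<Rightarrow> complex) \<Rightarrow> real ^ 'd::{finite,numeral} \<Rightarrow> complex" where
  "L_z \<phi> x = - \<i> * (complex_of_real (x $ 1) * weak_partial 2 \<phi> x
                   - complex_of_real (x $ 2) * weak_partial 1 \<phi> x)"

definition L_0 :: "(real ^ 'd::{finite,numeral} \<Rightarrow> complex) \<Rightarrow> real ^ 'd::{finite,numeral} \<Rightarrow> complex" where
  "L_0 \<phi> x = \<i> * weak_partial 1 \<phi> x + weak_partial 2 \<phi> x"

definition L_1 :: "(real ^ 'd::{finite,numeral} \<Rightarrow> complex) \<Rightarrow> real ^ 'd::{finite,numeral} \<Rightarrow> complex" where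
  "L_1 \<phi> x = \<i> * weak_partial 1 \<phi> x - weak_partial 2 \<phi> x"

text \<open>The complex expressions inside \<open>Re\<close> in \<open>F_x\<close> and \<open>F_y\<close> are real, as shown below.\<close>

definition F_x :: "'d::finite spinor \<Rightarrow> real ^ 'd \<Rightarrow> real" where
  "F_x \<Phi> x = Re (1 / complex_of_real (sqrt 2) *
     (cnj (\<Phi> 1 x) * \<Phi> 0 x + cnj (\<Phi> 0 x) * (\<Phi> 1 x + \<Phi> (-1) x) + cnj (\<Phi> (-1) x) * \<Phi> 0 x))"

definition F_y :: "'d::finite spinor \<Rightarrow> real ^ 'd \<Rightarrow> real" where
  "F_y \<Phi> x = Re (\<i> / complex_of_real (sqrt 2) *
     (- (cnj (\<Phi> 1 x) * \<Phi> 0 x) + cnj (\<Phi> 0 x) * (\<Phi> 1 x - \<Phi> (-1) x) + cnj (\<Phi> (-1) x) * \<Phi> 0 x))"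

definition F_z :: "'d::finite spinor \<Rightarrow> real ^ 'd \<Rightarrow> real" where
  "F_z \<Phi> x = (cmod (\<Phi> 1 x))\<^sup>2 - (cmod (\<Phi> (-1) x))\<^sup>2"

lemma complex_of_real_F_x:
  "complex_of_real (F_x \<Phi> x) = 1 / complex_of_real (sqrt 2) *
     (cnj (\<Phi> 1 x) * \<Phi> 0 x + cnj (\<Phi> 0 x) * (\<Phi> 1 x + \<Phi> (-1) x) + cnj (\<Phi> (-1) x) * \<Phi> 0 x)"
  by (simp add: F_x_def complex_eq_iff Re_divide Im_divide field_simps)

lemma complex_of_real_F_y:
  "complex_of_real (F_y \<Phi> x) = \<i> / complex_of_real (sqrt 2) *
     (- (cnj (\<Phi> 1 x) * \<Phi> 0 x) + cnj (\<Phi> 0 x) * (\<Phi> 1 x - \<Phi> (-1) x) + cnj (\<Phi> (-1) x) * \<Phi> 0 x)"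
  by (simp add: F_y_def complex_eq_iff Re_divide Im_divide field_simps)

definition spin_norm_sq :: "'d::finite spinor \<Rightarrow> real ^ 'd \<Rightarrow> real" where
  "spin_norm_sq \<Phi> x = (F_x \<Phi> x)\<^sup>2 + (F_y \<Phi> x)\<^sup>2 + (F_z \<Phi> x)\<^sup>2"

definition soc_density :: "'d::{finite,numeral} spinor \<Rightarrow> real ^ 'd::{finite,numeral} \<Rightarrow> complex" where
  "soc_density \<Phi> x = cnj (\<Phi> 1 x) * L_0 (\<Phi> 0) x
     + cnj (\<Phi> 0 x) * (L_0 (\<Phi> (-1)) x + L_1 (\<Phi> 1) x)
     + cnj (\<Phi> (-1) x) * L_1 (\<Phi> 0) x"

definition E_kin :: "'d::finite spinor \<Rightarrow> real" where
  "E_kin \<Phi> = 1 / 2 * (LINT x|lebesgue. (\<Sum>l\<in>{-1..1}. \<Sum>i\<in>UNIV. (cmod (weak_partial i (\<Phi> l) x))\<^sup>2))"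

definition E_pot :: "(real ^ 'd::finite \<Rightarrow> real) \<Rightarrow> 'd spinor \<Rightarrow> real" where
  "E_pot V \<Phi> = (LINT x|lebesgue. (\<Sum>l\<in>{-1..1}. V x * (cmod (\<Phi> l x))\<^sup>2))"

definition E_spin :: "real \<Rightarrow> real \<Rightarrow> 'd::finite spinor \<Rightarrow> real" where
  "E_spin c\<^sub>0 c\<^sub>1 \<Phi> =
     (LINT x|lebesgue. c\<^sub>0 / 2 * (density \<Phi> x)\<^sup>2 + c\<^sub>1 / 2 * spin_norm_sq \<Phi> x)"

text \<open>For spinors in the admissible set the integrals in \<open>E_rot\<close> and \<open>E_soc\<close> are real, because
  \<open>L_z\<close> is symmetric and \<open>L_0\<close>, \<open>L_1\<close> are formal adjoints; \<open>Re\<close> only changes the type.\<close>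

definition E_rot :: "real \<Rightarrow> 'd::{finite,numeral} spinor \<Rightarrow> real" where
  "E_rot \<Omega> \<Phi> = - \<Omega> * Re (LINT x|lebesgue. (\<Sum>l\<in>{-1..1}. cnj (\<Phi> l x) * L_z (\<Phi> l) x))"

definition E_soc :: "real \<Rightarrow> 'd::{finite,numeral} spinor \<Rightarrow> real" where
  "E_soc \<gamma> \<Phi> = - \<gamma> * Re (LINT x|lebesgue. soc_density \<Phi> x)"

definition energy ::
    "(real ^ 'd::{finite,numeral} \<Rightarrow> real) \<Rightarrow> real \<Rightarrow> real \<Rightarrow> real \<Rightarrow> real \<Rightarrow> 'd spinor \<Rightarrow> real" where
  "energy V c\<^sub>0 c\<^sub>1 \<Omega> \<gamma> \<Phi> =
     E_kin \<Phi> + E_pot V \<Phi> + E_spin c\<^sub>0 c\<^sub>1 \<Phi> + E_rot \<Omega> \<Phi> + E_soc \<gamma> \<Phi>"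

definition ground_state ::
    "(real ^ 'd::{finite,numeral} \<Rightarrow> real) \<Rightarrow> real \<Rightarrow> real \<Rightarrow> real \<Rightarrow> real \<Rightarrow> 'd spinor \<Rightarrow> bool" where
  "ground_state V c\<^sub>0 c\<^sub>1 \<Omega> \<gamma> \<Phi> \<longleftrightarrow> \<Phi> \<in> admissible V \<and>
     (\<forall>\<Psi>\<in>admissible V. energy V c\<^sub>0 c\<^sub>1 \<Omega> \<gamma> \<Phi> \<le> energy V c\<^sub>0 c\<^sub>1 \<Omega> \<gamma> \<Psi>)"

end

theory Submission
  imports Defs
begin

text \<open>The identity is a virial identity: it says that the energy is stationary at \<open>\<Phi>\<close> under the
  dilations \<open>\<Phi>\<^sub>s(x) = s\<^bsup>d/2\<^esup> \<Phi>(s x)\<close>, \<open>s > 0\<close>, which map the admissible set to itself. For a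
  quadratic trap the substitution \<open>x \<mapsto> s x\<close> gives
  \<open>E(\<Phi>\<^sub>s) = s\<^sup>2 E_kin(\<Phi>) + s\<^bsup>-2\<^esup> E_pot(\<Phi>) + s\<^bsup>d\<^esup> E_spin(\<Phi>) + E_rot(\<Phi>) + s E_soc(\<Phi>)\<close>.
  For a ground state this function of \<open>s\<close> is minimal at \<open>s = 1\<close>, and its derivative there is the
  left-hand side of the identity (\<open>ground_state_virial\<close>). Finiteness of the individual energies plays
  no role: \<open>integral_scaleR_arg\<close> also holds for non-integrable functions, with both integrals zero, so
  no Sobolev embedding is needed for the quartic term.

  The energies involve \<open>weak_partial\<close>, an arbitrary choice of a weak derivative. The chain rule for
  dilations (\<open>has_weak_partial_dilate\<close>) only says that the rescaled derivative is one weak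
  derivative of the dilated function; to compare it with the chosen one, weak derivatives have to be
  unique almost everywhere (\<open>weak_partial_unique\<close>). This is the fundamental lemma of the calculus of
  variations: the indicator of every open box is a bounded pointwise limit of smooth functions
  supported in the closure of the box, so the difference of two weak derivatives has integral zero
  over every box, and hence vanishes almost everywhere.\<close>

section \<open>Smooth cut-off functions\<close>

text \<open>The function \<open>t \<mapsto> p(1/t) exp(-1/t)\<close> on the positive half line, extended by zero. The polynomial
  is a parameter so that the class of these functions is closed under differentiation.\<close>

definition flat :: "real poly \<Rightarrow> real \<Rightarrow> real" where
  "flat p t = (if t > 0 then poly p (1 / t) * exp (- 1 / t) else 0)"

lemma poly_times_exp_neg_tendsto_0: "((\<lambda>u. poly p u * exp (- u)) \<longlongrightarrow> (0::real)) at_top"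
proof -
  have "((\<lambda>u. \<Sum>i\<le>degree p. coeff p i * (u ^ i / exp u)) \<longlongrightarrow> (\<Sum>i\<le>degree p. coeff p i * 0)) at_top"
    by (intro tendsto_sum tendsto_mult tendsto_const tendsto_power_div_exp_0)
  moreover have "(\<Sum>i\<le>degree p. coeff p i * (u ^ i / exp u)) = poly p u * exp (- u)" for u
    by (simp add: poly_altdef sum_distrib_right exp_minus divide_inverse mult.assoc)
  ultimately show ?thesis by simp
qed

text \<open>For \<open>t > 0\<close> and \<open>u = 1/t\<close>, the derivative of \<open>p(u) exp(-u)\<close> with respect to \<open>t\<close> is
  \<open>u\<^sup>2 (p(u) - p'(u)) exp(-u)\<close>.\<close>

lemma DERIV_flat:
  "(flat p has_real_derivative flat (monom 1 2 * (p - pderiv p)) t) (at t)"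
proof -
  consider "t > 0" | "t < 0" | "t = 0" by linarith
  then show ?thesis
  proof cases
    case 1
    have d: "((\<lambda>t. poly p (1 / t) * exp (- 1 / t)) has_real_derivative
          flat (monom 1 2 * (p - pderiv p)) t) (at t)"
      using 1 by (auto intro!: derivative_eq_intros DERIV_chain2[OF poly_DERIV]
          simp: flat_def poly_monom field_simps power2_eq_square)
    have "eventually (\<lambda>u. u \<in> {0<..}) (nhds t)"
      using 1 by (intro eventually_nhds_in_open) auto
    then have "eventually (\<lambda>u. flat p u = poly p (1 / u) * exp (- 1 / u)) (nhds t)"
      by (rule eventually_mono) (auto simp: flat_def)
    then show ?thesis using d by (subst DERIV_cong_ev[OF refl _ refl])
  next
    case 2
    have "eventually (\<lambda>u. u \<in> {..<0}) (nhds t)"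
      using 2 by (intro eventually_nhds_in_open) auto
    then have "eventually (\<lambda>u. flat p u = 0) (nhds t)"
      by (rule eventually_mono) (auto simp: flat_def)
    then show ?thesis
      using 2 by (subst DERIV_cong_ev[OF refl _ refl]) (auto simp: flat_def)
  next
    case 3
    have l: "((\<lambda>h. flat p h / h) \<longlongrightarrow> 0) (at_left 0)"
      by (rule tendsto_eventually) (auto simp: eventually_at_filter flat_def)
    \<comment> \<open>With \<open>u = 1/h\<close> the difference quotient at zero is \<open>u p(u) exp(-u)\<close>, and \<open>u \<rightarrow> \<infinity>\<close>.\<close>
    have "((\<lambda>h. poly (pCons 0 p) (inverse h) * exp (- inverse h)) \<longlongrightarrow> 0) (at_right (0::real))"
      by (rule filterlim_compose[OF poly_times_exp_neg_tendsto_0 filterlim_inverse_at_top_right])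
    moreover have "eventually (\<lambda>h. poly (pCons 0 p) (inverse h) * exp (- inverse h) = flat p h / h)
        (at_right (0::real))"
      by (auto simp: eventually_at_filter flat_def field_simps)
    ultimately have r: "((\<lambda>h. flat p h / h) \<longlongrightarrow> 0) (at_right 0)"
      by (rule Lim_transform_eventually)
    have "((\<lambda>h. flat p h / h) \<longlongrightarrow> 0) (at 0)"
      using l r by (rule filterlim_split_at)
    then show ?thesis
      using 3 by (simp add: DERIV_def flat_def)
  qed
qed

text \<open>The algebra generated by the constants and by flat functions of an affine function of one
  coordinate. It is closed under partial derivatives, so its elements are smooth.\<close>

inductive_set flat_algebra :: "(real ^ 'd::finite \<Rightarrow> real) set" where
  const: "(\<lambda>x. c) \<in> flat_algebra"
| flat: "(\<lambda>x. flat p (c * x $ i + e)) \<in> flat_algebra"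
| add: "f \<in> flat_algebra \<Longrightarrow> g \<in> flat_algebra \<Longrightarrow> (\<lambda>x. f x + g x) \<in> flat_algebra"
| mult: "f \<in> flat_algebra \<Longrightarrow> g \<in> flat_algebra \<Longrightarrow> (\<lambda>x. f x * g x) \<in> flat_algebra"

lemma flat_algebra_prod:
  assumes "finite I" "\<And>i. i \<in> I \<Longrightarrow> f i \<in> flat_algebra"
  shows "(\<lambda>x. \<Prod>i\<in>I. f i x) \<in> flat_algebra"
  using assms by (induction I rule: finite_induct) (auto intro: flat_algebra.intros)

lemma flat_algebra_has_derivative:
  assumes "f \<in> flat_algebra"
  shows "\<exists>g. (\<forall>i. g i \<in> flat_algebra) \<and>
           (\<forall>x. (f has_derivative (\<lambda>h. \<Sum>i\<in>UNIV. h $ i * g i x)) (at x))"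
  using assms
proof induction
  case (const c)
  show ?case
    by (rule exI[of _ "\<lambda>i x. 0"]) (auto intro: flat_algebra.intros)
next
  case (flat p c i e)
  let ?q = "monom 1 2 * (p - pderiv p)"
  let ?g = "\<lambda>j x. if j = i then c * flat ?q (c * x $ i + e) else 0"
  have "?g j \<in> flat_algebra" for j
    by (cases "j = i") (auto intro!: flat_algebra.intros)
  moreover have "((\<lambda>x. flat p (c * x $ i + e)) has_derivative (\<lambda>h. \<Sum>j\<in>UNIV. h $ j * ?g j x)) (at x)" for x
  proof -
    have "((\<lambda>x. c * x $ i + e) has_derivative (\<lambda>h. c * h $ i)) (at x)"
      by (auto intro!: derivative_eq_intros bounded_linear.has_derivative[OF bounded_linear_vec_nth])
    from has_derivative_compose[OF this DERIV_flat[unfolded has_field_derivative_def]]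
    show ?thesis by (simp add: if_distrib mult_ac cong: if_cong)
  qed
  ultimately show ?case by (intro exI[of _ ?g]) blast
next
  case (add f g)
  then obtain f' g' where "\<forall>i. f' i \<in> flat_algebra" "\<forall>i. g' i \<in> flat_algebra"
    "\<forall>x. (f has_derivative (\<lambda>h. \<Sum>i\<in>UNIV. h $ i * f' i x)) (at x)"
    "\<forall>x. (g has_derivative (\<lambda>h. \<Sum>i\<in>UNIV. h $ i * g' i x)) (at x)" by blast
  then show ?case
    by (intro exI[of _ "\<lambda>i x. f' i x + g' i x"])
      (auto intro!: flat_algebra.intros derivative_eq_intros simp: distrib_left sum.distrib)
next
  case (mult f g)
  then obtain f' g' where "\<forall>i. f' i \<in> flat_algebra" "\<forall>i. g' i \<in> flat_algebra"
    "\<forall>x. (f has_derivative (\<lambda>h. \<Sum>i\<in>UNIV. h $ i * f' i x)) (at x)"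
    "\<forall>x. (g has_derivative (\<lambda>h. \<Sum>i\<in>UNIV. h $ i * g' i x)) (at x)" by blast
  with mult show ?case
    by (intro exI[of _ "\<lambda>i x. f x * g' i x + f' i x * g x"])
      (auto intro!: flat_algebra.intros derivative_eq_intros
        simp: distrib_left sum.distrib sum_distrib_left sum_distrib_right mult_ac)
qed

lemma flat_algebra_C_k: "f \<in> flat_algebra \<Longrightarrow> C_k k f"
proof (induction k arbitrary: f)
  case 0
  then obtain g where "\<forall>x. (f has_derivative (\<lambda>h. \<Sum>i\<in>UNIV. h $ i * g i x)) (at x)"
    using flat_algebra_has_derivative by blast
  then show ?case
    by (auto intro!: continuous_at_imp_continuous_on has_derivative_continuous)
next
  case (Suc k)
  then obtain g where g: "\<forall>i. g i \<in> flat_algebra"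
    "\<forall>x. (f has_derivative (\<lambda>h. \<Sum>i\<in>UNIV. h $ i * g i x)) (at x)"
    using flat_algebra_has_derivative by blast
  have "classical_partial i f = g i" for i
  proof
    fix x
    have "frechet_derivative f (at x) = (\<lambda>h. \<Sum>i\<in>UNIV. h $ i * g i x)"
      by (rule frechet_derivative_at[symmetric]) (use g(2) in blast)
    then show "classical_partial i f x = g i x"
      by (simp add: classical_partial_def axis_def if_distrib if_distribR cong: if_cong)
  qed
  with g Suc show ?case
    by (auto simp: differentiable_def)
qed

text \<open>Smooth functions that vanish outside \<open>box a b\<close> and increase to its indicator as \<open>n\<close> grows,
  since \<open>exp (-1/(n t)) \<rightarrow> 1\<close> for every \<open>t > 0\<close>.\<close>

definition box_bump :: "nat \<Rightarrow> real ^ 'd \<Rightarrow> real ^ 'd \<Rightarrow> real ^ 'd::finite \<Rightarrow> real" where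
  "box_bump n a b x =
     (\<Prod>i\<in>UNIV. flat 1 (real n * (x $ i - a $ i)) * flat 1 (real n * (b $ i - x $ i)))"

lemma flat_1_bounds: "0 \<le> flat 1 t" "flat 1 t \<le> 1"
  by (auto simp: flat_def)

lemma box_bump_bounds: "0 \<le> box_bump n a b x" "box_bump n a b x \<le> 1"
  by (auto simp: box_bump_def flat_1_bounds mult_le_one intro!: prod_nonneg prod_le_1)

lemma box_bump_eq_0: "x \<notin> box a b \<Longrightarrow> box_bump n a b x = 0"
  by (force simp: box_bump_def flat_def mem_box_cart zero_less_mult_iff)

lemma box_bump_test_function: "box_bump n a b \<in> test_functions"
proof -
  have "(\<lambda>x. \<Prod>i\<in>UNIV. flat 1 (real n * x $ i + (- real n * a $ i)) *
      flat 1 (- real n * x $ i + real n * b $ i)) \<in> flat_algebra"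
    by (intro flat_algebra_prod flat_algebra.intros) auto
  also have "(\<lambda>x. \<Prod>i\<in>UNIV. flat 1 (real n * x $ i + (- real n * a $ i)) *
      flat 1 (- real n * x $ i + real n * b $ i)) = box_bump n a b"
    by (auto simp: box_bump_def fun_eq_iff algebra_simps intro!: prod.cong)
  finally have "C_k k (box_bump n a b)" for k
    by (rule flat_algebra_C_k)
  moreover have "{x. box_bump n a b x \<noteq> 0} \<subseteq> box a b"
    using box_bump_eq_0 by blast
  then have "compact (closure {x. box_bump n a b x \<noteq> 0})"
    using bounded_subset[OF bounded_box] by (simp add: compact_closure)
  ultimately show ?thesis by (simp add: test_functions_def)
qed

lemma box_bump_tendsto: "(\<lambda>n. box_bump n a b x) \<longlonglongrightarrow> indicator (box a b) x"
proof (cases "x \<in> box a b")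
  case True
  have *: "(\<lambda>n. flat 1 (real n * t)) \<longlonglongrightarrow> 1" if "t > 0" for t
  proof -
    have "(\<lambda>n. exp (- (1 / t) * inverse (real n))) \<longlonglongrightarrow> exp (- (1 / t) * 0)"
      by (intro tendsto_intros lim_inverse_n)
    moreover have "eventually (\<lambda>n. exp (- (1 / t) * inverse (real n)) = flat 1 (real n * t)) sequentially"
      using eventually_gt_at_top[of 0] by eventually_elim (use that in \<open>auto simp: flat_def field_simps\<close>)
    ultimately show ?thesis by (simp add: Lim_transform_eventually)
  qed
  have "(\<lambda>n. box_bump n a b x) \<longlonglongrightarrow> (\<Prod>i\<in>(UNIV::'a set). 1 * 1)"
    unfolding box_bump_def using True
    by (intro tendsto_prod tendsto_mult *) (auto simp: mem_box_cart)
  then show ?thesis using True by simp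
qed (simp add: box_bump_eq_0)

section \<open>Uniqueness of weak derivatives\<close>

lemma sigma_finite_lebesgue: "sigma_finite_measure (lebesgue :: 'a::euclidean_space measure)"
proof
  obtain A :: "'a set set" where "countable A" "A \<subseteq> sets lborel" "\<Union>A = space lborel" "\<forall>a\<in>A. emeasure lborel a \<noteq> \<infinity>"
    using lborel.sigma_finite_countable by blast
  then show "\<exists>A :: 'a set set. countable A \<and> A \<subseteq> sets lebesgue \<and> \<Union>A = space lebesgue \<and> (\<forall>a\<in>A. emeasure lebesgue a \<noteq> \<infinity>)"
    by (intro exI[of _ A]) (auto simp: subset_iff)
qed

text \<open>Boxes form an intersection-stable generator of the Borel sets, so vanishing integrals over all
  boxes give vanishing integrals over all measurable subsets of a fixed box.\<close>

lemma AE_eq_0_if_box_integrals_0: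
  fixes f :: "'a::euclidean_space \<Rightarrow> 'b::{banach, second_countable_topology}"
  assumes int: "\<And>a b. set_integrable lebesgue (box a b) f"
    and zero: "\<And>a b. set_lebesgue_integral lebesgue (box a b) f = 0"
  shows "AE x in lebesgue. f x = 0"
proof -
  have "AE x in lebesgue. indicat_real (box a b) x *\<^sub>R f x = 0" for a b
  proof (rule sigma_finite_measure.density_zero[OF sigma_finite_lebesgue])
    let ?h = "\<lambda>x. indicat_real (box a b) x *\<^sub>R f x"
    show h: "integrable lebesgue ?h"
      using int[of a b] by (simp add: set_integrable_def)
    have hA: "set_integrable lebesgue A ?h" if "A \<in> sets lebesgue" for A
      unfolding set_integrable_def using that h by (rule integrable_mult_indicator)
    have borel: "set_lebesgue_integral lebesgue A ?h = 0" if "A \<in> sets borel" for A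
    proof -
      have sets_borel: "sigma_sets UNIV (range (\<lambda>(a, b). box a b :: 'a set)) = sets borel"
        by (simp add: borel_eq_box)
      have "Int_stable (range (\<lambda>(a, b). box a b :: 'a set))"
        by (auto simp: Int_stable_def box_Int_box)
      moreover have "range (\<lambda>(a, b). box a b :: 'a set) \<subseteq> Pow UNIV" by auto
      moreover have "A \<in> sigma_sets UNIV (range (\<lambda>(a, b). box a b))"
        using that by (simp add: sets_borel)
      ultimately show ?thesis
      proof (induction rule: sigma_sets_induct_disjoint)
        case (basic A)
        then obtain c d where A: "A = box c d" by auto
        have "set_lebesgue_integral lebesgue A ?h = set_lebesgue_integral lebesgue (A \<inter> box a b) f"
          by (simp add: set_lebesgue_integral_def indicator_inter_arith)
        also have "\<dots> = 0"
          unfolding A box_Int_box by (rule zero)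
        finally show ?case .
      next
        case empty
        show ?case by (simp add: set_lebesgue_integral_def)
      next
        case (compl A)
        then have A: "A \<in> sets lebesgue" "UNIV - A \<in> sets lebesgue"
          using sets_borel by auto
        have "(LINT x:A \<union> (UNIV - A)|lebesgue. ?h x) =
            (LINT x:A|lebesgue. ?h x) + (LINT x:UNIV - A|lebesgue. ?h x)"
          by (rule set_integral_Un) (use A hA in auto)
        moreover have "(LINT x:A \<union> (UNIV - A)|lebesgue. ?h x) = 0"
          using zero[of a b] by (simp add: set_lebesgue_integral_def)
        ultimately show ?case using compl.IH by simp
      next
        case (union A)
        then have A: "A i \<in> sets lebesgue" for i
          using sets_borel by auto
        have "(\<Union>i. A i) \<in> sets lebesgue" using A by blast
        from lebesgue_integral_countable_add[OF A _ hA[OF this]] union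
        show ?case by (auto simp: disjoint_family_on_def)
      qed
    qed
    \<comment> \<open>A Lebesgue set is a Borel set up to a null set.\<close>
    fix A :: "'a set" assume "A \<in> sets lebesgue"
    then obtain S N N' where A: "A = S \<union> N" "N \<subseteq> N'" "N' \<in> null_sets lborel" "S \<in> sets lborel"
      by (rule sets_completionE)
    have "N' \<in> null_sets lebesgue"
      using A(3) by (simp add: null_sets_completionI)
    then have ae: "AE x in lebesgue. x \<notin> N'" by (rule AE_not_in)
    have S: "S \<in> sets lebesgue" using A by auto
    have "set_lebesgue_integral lebesgue A ?h = set_lebesgue_integral lebesgue S ?h"
      unfolding set_lebesgue_integral_def
    proof (rule integral_cong_AE)
      show "(\<lambda>x. indicat_real A x *\<^sub>R ?h x) \<in> borel_measurable lebesgue"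
        "(\<lambda>x. indicat_real S x *\<^sub>R ?h x) \<in> borel_measurable lebesgue"
        using hA[OF S] hA[OF \<open>A \<in> sets lebesgue\<close>] by (auto simp: set_integrable_def dest: borel_measurable_integrable)
      show "AE x in lebesgue. indicat_real A x *\<^sub>R ?h x = indicat_real S x *\<^sub>R ?h x"
        using ae by eventually_elim (use A in \<open>auto simp: indicator_def\<close>)
    qed
    then show "set_lebesgue_integral lebesgue A ?h = 0"
      using borel[of S] A by simp
  qed
  then have "AE x in lebesgue. \<forall>n::nat. indicat_real (box (- real n *\<^sub>R One) (real n *\<^sub>R One)) x *\<^sub>R f x = 0"
    by (subst AE_all_countable) blast
  then show ?thesis
  proof eventually_elim
    case (elim x)
    have "x \<in> (\<Union>n::nat. box (- real n *\<^sub>R One) (real n *\<^sub>R One))"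
      by (simp add: UN_box_eq_UNIV)
    then obtain n :: nat where "x \<in> box (- real n *\<^sub>R One) (real n *\<^sub>R One)" by blast
    with elim[rule_format, of n] show ?case by simp
  qed
qed

lemma L2_set_integrable_box:
  fixes g :: "real ^ 'd::finite \<Rightarrow> complex"
  assumes "g \<in> L2"
  shows "set_integrable lebesgue (box a b) g"
  unfolding set_integrable_def
proof (rule Bochner_Integration.integrable_bound)
  have [measurable]: "g \<in> borel_measurable lebesgue" using assms by (simp add: L2_def)
  have "integrable lebesgue (indicat_real (box a b))"
    by (rule integrable_real_indicator) (auto simp: emeasure_lborel_box_eq)
  then show "integrable lebesgue (\<lambda>x. indicat_real (box a b) x + (cmod (g x))\<^sup>2)"
    using assms by (simp add: L2_def)
  show "(\<lambda>x. indicat_real (box a b) x *\<^sub>R g x) \<in> borel_measurable lebesgue"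
    by (intro borel_measurable_scaleR borel_measurable_indicator) auto
  have "t \<le> 1 + t\<^sup>2" for t :: real
    by (smt (verit) power2_eq_square self_le_power zero_less_numeral zero_le_power2)
  then show "AE x in lebesgue. norm (indicat_real (box a b) x *\<^sub>R g x)
      \<le> norm (indicat_real (box a b) x + (cmod (g x))\<^sup>2)"
    by (auto simp: indicator_def)
qed

lemma weak_partial_unique:
  assumes "has_weak_partial i \<phi> g" "has_weak_partial i \<phi> h"
  shows "AE x in lebesgue. g x = h x"
proof -
  have L2: "g \<in> L2" "h \<in> L2" using assms by (auto simp: has_weak_partial_def)
  have eq: "(LINT x|lebesgue. g x * complex_of_real (\<psi> x)) = (LINT x|lebesgue. h x * complex_of_real (\<psi> x))"
    if "\<psi> \<in> test_functions" for \<psi>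
    using assms that by (simp add: has_weak_partial_def)
  have lim: "(\<lambda>n. LINT x|lebesgue. f x * complex_of_real (box_bump n a b x))
      \<longlonglongrightarrow> set_lebesgue_integral lebesgue (box a b) f" if "f \<in> L2" for f :: "real ^ 'a \<Rightarrow> complex" and a b
    unfolding set_lebesgue_integral_def
  proof (rule integral_dominated_convergence)
    have [measurable]: "f \<in> borel_measurable lebesgue" using that by (simp add: L2_def)
    have "continuous_on UNIV (box_bump n a b)" for n
      using box_bump_test_function[of n a b] C_k.simps(1) by (auto simp: test_functions_def simp del: C_k.simps)
    then have "box_bump n a b \<in> borel_measurable borel" for n
      by (rule borel_measurable_continuous_onI)
    then have [measurable]: "box_bump n a b \<in> borel_measurable lebesgue" for n
      by (simp add: measurable_completion)
    show "(\<lambda>x. indicat_real (box a b) x *\<^sub>R f x) \<in> borel_measurable lebesgue"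
      "(\<lambda>x. f x * complex_of_real (box_bump n a b x)) \<in> borel_measurable lebesgue" for n
      by (auto intro!: borel_measurable_scaleR borel_measurable_indicator borel_measurable_times
        borel_measurable_of_real)
    show "integrable lebesgue (\<lambda>x. norm (indicat_real (box a b) x *\<^sub>R f x))"
      using L2_set_integrable_box[OF that, of a b] by (simp add: set_integrable_def del: norm_scaleR)
    have "(\<lambda>n. f x * complex_of_real (box_bump n a b x)) \<longlonglongrightarrow>
        f x * complex_of_real (indicat_real (box a b) x)" for x
      by (intro tendsto_intros box_bump_tendsto)
    then show "AE x in lebesgue. (\<lambda>n. f x * complex_of_real (box_bump n a b x)) \<longlonglongrightarrow>
        indicat_real (box a b) x *\<^sub>R f x"
      by (simp add: scaleR_conv_of_real mult.commute)
    show "AE x in lebesgue. norm (f x * complex_of_real (box_bump n a b x))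
        \<le> norm (indicat_real (box a b) x *\<^sub>R f x)" for n
    proof (rule AE_I2)
      fix x
      show "norm (f x * complex_of_real (box_bump n a b x)) \<le> norm (indicat_real (box a b) x *\<^sub>R f x)"
        using box_bump_bounds[of n a b x] box_bump_eq_0[of x a b n]
        by (auto simp: norm_mult indicator_def mult_left_le)
    qed
  qed
  have "AE x in lebesgue. g x - h x = 0"
  proof (rule AE_eq_0_if_box_integrals_0)
    fix a b :: "real ^ 'a"
    have "set_lebesgue_integral lebesgue (box a b) g = set_lebesgue_integral lebesgue (box a b) h"
      using lim[OF L2(1), of a b] lim[OF L2(2), of a b] eq[OF box_bump_test_function]
      by (simp add: LIMSEQ_unique)
    then show "set_lebesgue_integral lebesgue (box a b) (\<lambda>x. g x - h x) = 0"
      using L2 by (simp add: L2_set_integrable_box)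
    show "set_integrable lebesgue (box a b) (\<lambda>x. g x - h x)"
      using L2 by (simp add: L2_set_integrable_box)
  qed
  then show ?thesis by simp
qed

section \<open>Dilations\<close>

lemma lebesgue_eq_density_distr_scaleR:
  fixes s :: real
  assumes "s > 0"
  shows "(lebesgue :: (real ^ 'd::finite) measure) =
    Nonnegative_Lebesgue_Integration.density (distr lebesgue lebesgue ((*\<^sub>R) s)) (\<lambda>_. s ^ CARD('d))"
proof -
  have "(\<lambda>x :: real ^ 'd. 0 + (\<Sum>j\<in>Basis. (s * (x \<bullet> j)) *\<^sub>R j)) = (*\<^sub>R) s"
    by (simp add: fun_eq_iff scaleR_sum_right[symmetric] euclidean_representation flip: scaleR_scaleR)
  then show ?thesis
    using lebesgue_affine_euclidean[of "\<lambda>_. s" "0 :: real ^ 'd"] assms by (simp add: ennreal_power)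
qed

lemma has_bochner_integral_scaleR_arg:
  fixes f :: "real ^ 'd::finite \<Rightarrow> 'b::{banach, second_countable_topology}"
  assumes "s > 0" and f: "integrable lebesgue f"
  shows "has_bochner_integral lebesgue (\<lambda>x. f (s *\<^sub>R x)) ((1 / s ^ CARD('d)) *\<^sub>R integral\<^sup>L lebesgue f)"
proof -
  let ?D = "distr lebesgue lebesgue ((*\<^sub>R) s) :: (real ^ 'd) measure"
  have [measurable]: "f \<in> borel_measurable lebesgue" using f by simp
  have meas: "f \<in> borel_measurable ?D" by simp
  have f': "integrable (Nonnegative_Lebesgue_Integration.density ?D (\<lambda>_. ennreal (s ^ CARD('d)))) f"
    using f lebesgue_eq_density_distr_scaleR[OF \<open>s > 0\<close>, where 'd='d] by simp
  then have "integrable ?D (\<lambda>x. s ^ CARD('d) *\<^sub>R f x)"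
    using \<open>s > 0\<close> by (subst (asm) integrable_density) auto
  from integrable_scaleR_right[OF this, of "1 / s ^ CARD('d)"] have "integrable ?D f"
    using \<open>s > 0\<close> by simp
  then have int: "integrable lebesgue (\<lambda>x. f (s *\<^sub>R x))"
    by (rule integrable_distr[OF lebesgue_measurable_scaling])
  have "integral\<^sup>L lebesgue f = integral\<^sup>L (Nonnegative_Lebesgue_Integration.density ?D (\<lambda>_. ennreal (s ^ CARD('d)))) f"
    using lebesgue_eq_density_distr_scaleR[OF \<open>s > 0\<close>, where 'd='d] by simp
  also have "\<dots> = (LINT x|?D. s ^ CARD('d) *\<^sub>R f x)"
    using \<open>s > 0\<close> by (subst integral_density) auto
  also have "\<dots> = s ^ CARD('d) *\<^sub>R (LINT x|lebesgue. f (s *\<^sub>R x))"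
    by (simp add: integral_distr[OF lebesgue_measurable_scaling])
  finally show ?thesis
    using int \<open>s > 0\<close> by (simp add: has_bochner_integral_iff)
qed

lemma integrable_scaleR_arg_iff:
  fixes f :: "real ^ 'd::finite \<Rightarrow> 'b::{banach, second_countable_topology}"
  assumes "s > 0"
  shows "integrable lebesgue (\<lambda>x. f (s *\<^sub>R x)) \<longleftrightarrow> integrable lebesgue f"
proof
  assume "integrable lebesgue (\<lambda>x. f (s *\<^sub>R x))"
  from has_bochner_integral_scaleR_arg[OF _ this, of "1 / s"] assms
  show "integrable lebesgue f" by (simp add: has_bochner_integral_iff)
next
  assume "integrable lebesgue f"
  from has_bochner_integral_scaleR_arg[OF assms this]
  show "integrable lebesgue (\<lambda>x. f (s *\<^sub>R x))" by (simp add: has_bochner_integral_iff)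
qed

text \<open>No integrability is required: if one side is not integrable, then neither is the other, and
  both integrals have the default value zero.\<close>

lemma integral_scaleR_arg:
  fixes f :: "real ^ 'd::finite \<Rightarrow> 'b::{banach, second_countable_topology}"
  assumes "s > 0"
  shows "(LINT x|lebesgue. f (s *\<^sub>R x)) = (1 / s ^ CARD('d)) *\<^sub>R integral\<^sup>L lebesgue f"
proof (cases "integrable lebesgue f")
  case True
  from has_bochner_integral_scaleR_arg[OF assms this] show ?thesis
    by (simp add: has_bochner_integral_iff)
next
  case False
  then show ?thesis
    using assms by (simp add: integrable_scaleR_arg_iff not_integrable_integral_eq)
qed

lemma AE_scaleR_arg:
  fixes P :: "real ^ 'd::finite \<Rightarrow> bool"
  assumes "s > 0" "AE x in lebesgue. P x"
  shows "AE x in lebesgue. P (s *\<^sub>R x)"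
proof -
  have "AE x in Nonnegative_Lebesgue_Integration.density (distr lebesgue lebesgue ((*\<^sub>R) s)) (\<lambda>_. s ^ CARD('d)). P x"
    using assms(2) by (subst (asm) lebesgue_eq_density_distr_scaleR[OF \<open>s > 0\<close>])
  then have "AE x in distr lebesgue lebesgue ((*\<^sub>R) s). P x"
    using \<open>s > 0\<close> by (subst (asm) AE_density) auto
  then show ?thesis
    by (rule AE_distrD[OF lebesgue_measurable_scaling])
qed

lemma classical_partial_scaleR_arg:
  assumes "\<And>x. \<psi> differentiable (at x)"
  shows "classical_partial i (\<lambda>x. a * \<psi> (c *\<^sub>R x)) x = a * c * classical_partial i \<psi> (c *\<^sub>R x)"
    and "(\<lambda>x. a * \<psi> (c *\<^sub>R x)) differentiable (at x)"
proof -
  let ?D = "frechet_derivative \<psi> (at (c *\<^sub>R x))"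
  have D: "(\<psi> has_derivative ?D) (at (c *\<^sub>R x))"
    using assms frechet_derivative_works by blast
  have "((\<lambda>x. c *\<^sub>R x) has_derivative (\<lambda>h. c *\<^sub>R h)) (at x)"
    by (auto intro!: derivative_eq_intros)
  from has_derivative_compose[OF this D]
  have *: "((\<lambda>x. a * \<psi> (c *\<^sub>R x)) has_derivative (\<lambda>h. a * ?D (c *\<^sub>R h))) (at x)"
    by (rule has_derivative_mult_right)
  then show "(\<lambda>x. a * \<psi> (c *\<^sub>R x)) differentiable (at x)"
    by (auto simp: differentiable_def)
  show "classical_partial i (\<lambda>x. a * \<psi> (c *\<^sub>R x)) x = a * c * classical_partial i \<psi> (c *\<^sub>R x)"
    using linear_cmul[OF has_derivative_linear[OF D]]
    by (simp add: classical_partial_def frechet_derivative_at[OF *, symmetric])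
qed

lemma C_k_scaleR_arg: "C_k k \<psi> \<Longrightarrow> C_k k (\<lambda>x. a * \<psi> (c *\<^sub>R x))"
proof (induction k arbitrary: \<psi> a)
  case 0
  then show ?case
    by (auto intro!: continuous_intros continuous_on_compose2[of UNIV \<psi>])
next
  case (Suc k)
  then have d: "\<And>x. \<psi> differentiable (at x)" and C: "\<And>i. C_k k (classical_partial i \<psi>)"
    by auto
  have "classical_partial i (\<lambda>x. a * \<psi> (c *\<^sub>R x)) = (\<lambda>x. a * c * classical_partial i \<psi> (c *\<^sub>R x))" for i
    using classical_partial_scaleR_arg(1)[OF d] by (rule ext)
  with Suc.IH[OF C] classical_partial_scaleR_arg(2)[OF d] show ?case
    unfolding C_k.simps by presburger
qed

lemma test_functions_scaleR_arg:
  assumes "\<psi> \<in> test_functions" "c \<noteq> 0"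
  shows "(\<lambda>x. \<psi> (c *\<^sub>R x)) \<in> test_functions"
proof -
  have "{x. \<psi> (c *\<^sub>R x) \<noteq> 0} \<subseteq> (*\<^sub>R) (1 / c) ` closure {x. \<psi> x \<noteq> 0}"
  proof
    fix x assume "x \<in> {x. \<psi> (c *\<^sub>R x) \<noteq> 0}"
    then have "c *\<^sub>R x \<in> closure {x. \<psi> x \<noteq> 0}"
      by (intro subsetD[OF closure_subset]) simp
    then show "x \<in> (*\<^sub>R) (1 / c) ` closure {x. \<psi> x \<noteq> 0}"
      by (rule rev_image_eqI) (use \<open>c \<noteq> 0\<close> in simp)
  qed
  moreover have "compact ((*\<^sub>R) (1 / c) ` closure {x. \<psi> x \<noteq> 0})"
    using assms by (intro compact_scaling) (simp add: test_functions_def)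
  ultimately have "bounded {x. \<psi> (c *\<^sub>R x) \<noteq> 0}"
    using bounded_subset compact_imp_bounded by blast
  then show ?thesis
    using assms C_k_scaleR_arg[of _ \<psi> 1 c] by (simp add: test_functions_def compact_closure)
qed

text \<open>The dilation \<open>\<phi> \<mapsto> s\<^bsup>d/2\<^esup> \<phi>(s x)\<close>; the factor makes it preserve the norm of \<open>L\<^sup>2\<close> for \<open>s > 0\<close>.\<close>

definition dilate :: "real \<Rightarrow> (real ^ 'd::finite \<Rightarrow> complex) \<Rightarrow> real ^ 'd \<Rightarrow> complex" where
  "dilate s \<phi> x = complex_of_real (s powr (real CARD('d) / 2)) * \<phi> (s *\<^sub>R x)"

lemma dilate_factor_square:
  "s > 0 \<Longrightarrow> s powr (real CARD('d::finite) / 2) * s powr (real CARD('d) / 2) = s ^ CARD('d)"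
  by (simp add: powr_add[symmetric] powr_realpow)

lemma cnj_dilate_mult_dilate:
  fixes \<phi> :: "real ^ 'd::finite \<Rightarrow> complex"
  assumes "s > 0"
  shows "cnj (dilate s \<phi> x) * dilate s \<eta> x =
    complex_of_real (s ^ CARD('d)) * (cnj (\<phi> (s *\<^sub>R x)) * \<eta> (s *\<^sub>R x))"
  unfolding dilate_factor_square[OF assms, where 'd='d, symmetric] by (simp add: dilate_def mult_ac)

lemma cmod_dilate_square:
  fixes \<phi> :: "real ^ 'd::finite \<Rightarrow> complex"
  assumes "s > 0"
  shows "(cmod (dilate s \<phi> x))\<^sup>2 = s ^ CARD('d) * (cmod (\<phi> (s *\<^sub>R x)))\<^sup>2"
  unfolding dilate_factor_square[OF assms, where 'd='d, symmetric]
  by (simp add: dilate_def norm_mult power_mult_distrib power2_eq_square)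

lemma dilate_L2:
  assumes "s > 0" "\<phi> \<in> L2"
  shows "dilate s \<phi> \<in> L2"
proof -
  have "(\<lambda>x. \<phi> (s *\<^sub>R x)) \<in> borel_measurable lebesgue"
    using assms by (intro measurable_compose[OF lebesgue_measurable_scaling]) (simp add: L2_def)
  then have "dilate s \<phi> \<in> borel_measurable lebesgue"
    unfolding dilate_def[abs_def] by (intro borel_measurable_times) auto
  moreover have "integrable lebesgue (\<lambda>x. (cmod (\<phi> (s *\<^sub>R x)))\<^sup>2)"
    using assms by (subst integrable_scaleR_arg_iff[of s "\<lambda>x. (cmod (\<phi> x))\<^sup>2"]) (auto simp: L2_def)
  ultimately show ?thesis
    using assms by (simp add: L2_def cmod_dilate_square)
qed

text \<open>Substituting \<open>s x\<close> turns the pairing of \<open>dilate s \<phi>\<close> with \<open>\<psi>\<close> into the pairing of \<open>\<phi>\<close> with the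
  test function \<open>\<psi>(x / s)\<close>.\<close>

lemma has_weak_partial_dilate:
  fixes \<phi> g :: "real ^ 'd::finite \<Rightarrow> complex"
  assumes "s > 0" and w: "has_weak_partial i \<phi> g"
  shows "has_weak_partial i (dilate s \<phi>) (\<lambda>x. complex_of_real s * dilate s g x)"
  unfolding has_weak_partial_def
proof (intro conjI ballI)
  have L2: "\<phi> \<in> L2" "g \<in> L2" using w by (auto simp: has_weak_partial_def)
  show "dilate s \<phi> \<in> L2" using L2 \<open>s > 0\<close> by (intro dilate_L2)
  have "dilate s g \<in> L2" using L2 \<open>s > 0\<close> by (intro dilate_L2)
  then show "(\<lambda>x. complex_of_real s * dilate s g x) \<in> L2"
    by (auto simp: L2_def norm_mult power_mult_distrib intro!: borel_measurable_times)
  fix \<psi> :: "real ^ 'd \<Rightarrow> real" assume \<psi>: "\<psi> \<in> test_functions"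
  define \<alpha> where "\<alpha> = complex_of_real (s powr (real CARD('d) / 2))"
  define \<psi>' where "\<psi>' = (\<lambda>x. \<psi> ((1 / s) *\<^sub>R x))"
  have \<psi>': "\<psi>' \<in> test_functions"
    unfolding \<psi>'_def using \<psi> \<open>s > 0\<close> by (intro test_functions_scaleR_arg) auto
  have "\<forall>x. \<psi>' differentiable (at x)"
    using \<psi>' C_k.simps(2)[of 0 \<psi>'] by (auto simp: test_functions_def simp del: C_k.simps)
  then have d: "classical_partial i \<psi> x = s * classical_partial i \<psi>' (s *\<^sub>R x)" for x
    using classical_partial_scaleR_arg(1)[of \<psi>' i 1 s x] \<open>s > 0\<close> by (simp add: \<psi>'_def)
  have "(LINT x|lebesgue. dilate s \<phi> x * complex_of_real (classical_partial i \<psi> x)) =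
      (LINT x|lebesgue. \<alpha> * s * (\<phi> (s *\<^sub>R x) * complex_of_real (classical_partial i \<psi>' (s *\<^sub>R x))))"
    by (simp add: d dilate_def \<alpha>_def mult_ac)
  also have "\<dots> = (1 / s ^ CARD('d)) *\<^sub>R (LINT x|lebesgue. \<alpha> * s * (\<phi> x * complex_of_real (classical_partial i \<psi>' x)))"
    by (rule integral_scaleR_arg[OF \<open>s > 0\<close>])
  also have "\<dots> = (1 / s ^ CARD('d)) *\<^sub>R (\<alpha> * s * (LINT x|lebesgue. \<phi> x * complex_of_real (classical_partial i \<psi>' x)))"
    by simp
  also have "\<dots> = - ((1 / s ^ CARD('d)) *\<^sub>R (\<alpha> * s * (LINT x|lebesgue. g x * complex_of_real (\<psi>' x))))"
    using w \<psi>' by (simp add: has_weak_partial_def)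
  also have "\<dots> = - ((1 / s ^ CARD('d)) *\<^sub>R (LINT x|lebesgue. \<alpha> * s * (g x * complex_of_real (\<psi>' x))))"
    by simp
  also have "\<dots> = - (LINT x|lebesgue. \<alpha> * s * (g (s *\<^sub>R x) * complex_of_real (\<psi>' (s *\<^sub>R x))))"
    by (subst integral_scaleR_arg[OF \<open>s > 0\<close>]) (rule refl)
  also have "\<dots> = - (LINT x|lebesgue. complex_of_real s * dilate s g x * complex_of_real (\<psi> x))"
    using \<open>s > 0\<close> by (simp add: \<psi>'_def dilate_def \<alpha>_def mult_ac)
  finally show "(LINT x|lebesgue. dilate s \<phi> x * complex_of_real (classical_partial i \<psi> x)) =
      - (LINT x|lebesgue. complex_of_real s * dilate s g x * complex_of_real (\<psi> x))" .
qed

lemma has_weak_partial_weak_partial: "\<phi> \<in> H1 \<Longrightarrow> has_weak_partial i \<phi> (weak_partial i \<phi>)"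
  using someI_ex[of "has_weak_partial i \<phi>"] by (auto simp: weak_partial_def H1_def)

lemma dilate_H1:
  assumes "s > 0" "\<phi> \<in> H1"
  shows "dilate s \<phi> \<in> H1"
  using assms has_weak_partial_dilate[OF \<open>s > 0\<close>] by (auto simp: H1_def intro: dilate_L2) blast

text \<open>The chain rule for the chosen derivatives: both sides are weak derivatives of the same function,
  so they agree off a null set, and finitely many null sets can be merged.\<close>

lemma AE_weak_partial_dilate:
  assumes "s > 0" "\<forall>l\<in>{-1..1::int}. \<Phi> l \<in> H1"
  shows "AE x in lebesgue. \<forall>l\<in>{-1..1}. \<forall>i.
    weak_partial i (dilate s (\<Phi> l)) x = complex_of_real s * dilate s (weak_partial i (\<Phi> l)) x"
proof -
  have "AE x in lebesgue.
      weak_partial i (dilate s (\<Phi> l)) x = complex_of_real s * dilate s (weak_partial i (\<Phi> l)) x"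
    if "l \<in> {-1..1}" for l i
    using weak_partial_unique[OF has_weak_partial_weak_partial has_weak_partial_dilate]
      dilate_H1 has_weak_partial_weak_partial assms(1) assms(2)[rule_format, OF that] by blast
  then show ?thesis
    by (simp add: AE_ball_countable AE_all_countable)
qed

lemma H1_measurable:
  assumes "\<phi> \<in> H1"
  shows "\<phi> \<in> borel_measurable lebesgue" "weak_partial i \<phi> \<in> borel_measurable lebesgue"
  using assms has_weak_partial_weak_partial[OF assms, of i]
  by (auto simp: H1_def L2_def has_weak_partial_def)

lemma borel_measurable_cnj:
  "f \<in> borel_measurable M \<Longrightarrow> (\<lambda>x. cnj (f x)) \<in> borel_measurable M"
  by (intro borel_measurable_continuous_on[of cnj]) (auto intro: continuous_intros)

lemma borel_measurable_of_real_vec_nth: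
  "(\<lambda>x :: real ^ 'd::finite. complex_of_real (x $ i)) \<in> borel_measurable lebesgue"
  by (intro measurable_completion) simp

section \<open>Scaling of the energies\<close>

lemma density_dilate:
  fixes \<Phi> :: "'d::finite spinor"
  assumes "s > 0"
  shows "density (\<lambda>l. dilate s (\<Phi> l)) x = s ^ CARD('d) * density \<Phi> (s *\<^sub>R x)"
  using assms by (simp add: density_def cmod_dilate_square sum_distrib_left)

lemma harmonic_potential_scaleR:
  "harmonic_potential \<omega> (s *\<^sub>R x) = s\<^sup>2 * harmonic_potential \<omega> x"
  by (simp add: harmonic_potential_def sum_distrib_left power_mult_distrib mult_ac)

lemma harmonic_potential_dilate:
  fixes \<phi> :: "real ^ 'd::finite \<Rightarrow> complex"
  assumes "s > 0"
  shows "harmonic_potential \<omega> x * (cmod (dilate s \<phi> x))\<^sup>2 =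
    s ^ CARD('d) / s\<^sup>2 * (harmonic_potential \<omega> (s *\<^sub>R x) * (cmod (\<phi> (s *\<^sub>R x)))\<^sup>2)"
  using assms by (simp add: harmonic_potential_scaleR cmod_dilate_square)

lemma dilate_admissible:
  fixes \<Phi> :: "'d::finite spinor"
  assumes "s > 0" "\<Phi> \<in> admissible (harmonic_potential \<omega>)"
  shows "(\<lambda>l. dilate s (\<Phi> l)) \<in> admissible (harmonic_potential \<omega>)"
proof -
  have "integrable lebesgue (\<lambda>x. harmonic_potential \<omega> (s *\<^sub>R x) * (cmod (\<Phi> j (s *\<^sub>R x)))\<^sup>2)"
    if "j \<in> {-1..1}" for j
    using assms that integrable_scaleR_arg_iff[of s "\<lambda>x. harmonic_potential \<omega> x * (cmod (\<Phi> j x))\<^sup>2"]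
    by (auto simp: admissible_def L2_weighted_def)
  then have "dilate s (\<Phi> j) \<in> L2_weighted (harmonic_potential \<omega>)" if "j \<in> {-1..1}" for j
    using that \<open>s > 0\<close> by (simp add: L2_weighted_def harmonic_potential_dilate)
  moreover have "(LINT x|lebesgue. density (\<lambda>l. dilate s (\<Phi> l)) x) = 1"
    using assms integral_scaleR_arg[OF \<open>s > 0\<close>, of "density \<Phi>"]
    by (simp add: density_dilate admissible_def)
  ultimately show ?thesis
    using assms dilate_H1[OF \<open>s > 0\<close>] by (auto simp: admissible_def)
qed

lemma E_pot_dilate:
  fixes \<Phi> :: "'d::finite spinor"
  assumes "s > 0"
  shows "E_pot (harmonic_potential \<omega>) (\<lambda>l. dilate s (\<Phi> l)) = E_pot (harmonic_potential \<omega>) \<Phi> / s\<^sup>2"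
proof -
  have "E_pot (harmonic_potential \<omega>) (\<lambda>l. dilate s (\<Phi> l)) =
     s ^ CARD('d) / s\<^sup>2 * (LINT x|lebesgue. (\<Sum>l\<in>{-1..1}.
        harmonic_potential \<omega> (s *\<^sub>R x) * (cmod (\<Phi> l (s *\<^sub>R x)))\<^sup>2))"
    unfolding E_pot_def harmonic_potential_dilate[OF assms]
    by (simp only: sum_distrib_left[symmetric] integral_mult_right_zero)
  also have "\<dots> = E_pot (harmonic_potential \<omega>) \<Phi> / s\<^sup>2"
    using assms
    by (subst integral_scaleR_arg[OF assms, of "\<lambda>x. \<Sum>l\<in>{-1..1}. harmonic_potential \<omega> x * (cmod (\<Phi> l x))\<^sup>2"])
      (simp add: E_pot_def)
  finally show ?thesis .
qed

lemma spin_norm_sq_dilate: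
  fixes \<Phi> :: "'d::finite spinor"
  assumes "s > 0"
  shows "spin_norm_sq (\<lambda>l. dilate s (\<Phi> l)) x = (s ^ CARD('d))\<^sup>2 * spin_norm_sq \<Phi> (s *\<^sub>R x)"
proof -
  let ?\<Psi> = "\<lambda>l. dilate s (\<Phi> l)"
  have "complex_of_real (F_x ?\<Psi> x) = complex_of_real (s ^ CARD('d) * F_x \<Phi> (s *\<^sub>R x))"
    unfolding of_real_mult complex_of_real_F_x distrib_left cnj_dilate_mult_dilate[OF assms]
    by (simp add: algebra_simps)
  moreover have "complex_of_real (F_y ?\<Psi> x) = complex_of_real (s ^ CARD('d) * F_y \<Phi> (s *\<^sub>R x))"
    unfolding of_real_mult complex_of_real_F_y right_diff_distrib cnj_dilate_mult_dilate[OF assms]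
    by (simp add: algebra_simps)
  moreover have "F_z ?\<Psi> x = s ^ CARD('d) * F_z \<Phi> (s *\<^sub>R x)"
    by (simp add: F_z_def cmod_dilate_square[OF assms] right_diff_distrib)
  ultimately show ?thesis
    unfolding of_real_eq_iff by (simp add: spin_norm_sq_def power_mult_distrib distrib_left)
qed

lemma E_spin_dilate:
  fixes \<Phi> :: "'d::finite spinor"
  assumes "s > 0"
  shows "E_spin c\<^sub>0 c\<^sub>1 (\<lambda>l. dilate s (\<Phi> l)) = s ^ CARD('d) * E_spin c\<^sub>0 c\<^sub>1 \<Phi>"
proof -
  let ?e = "\<lambda>x. c\<^sub>0 / 2 * (density \<Phi> x)\<^sup>2 + c\<^sub>1 / 2 * spin_norm_sq \<Phi> x"
  have "E_spin c\<^sub>0 c\<^sub>1 (\<lambda>l. dilate s (\<Phi> l)) = (LINT x|lebesgue. (s ^ CARD('d))\<^sup>2 * ?e (s *\<^sub>R x))"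
    unfolding E_spin_def density_dilate[OF assms] spin_norm_sq_dilate[OF assms]
    by (simp add: power_mult_distrib distrib_left mult_ac)
  also have "\<dots> = (s ^ CARD('d))\<^sup>2 * ((1 / s ^ CARD('d)) * E_spin c\<^sub>0 c\<^sub>1 \<Phi>)"
    unfolding integral_mult_right_zero integral_scaleR_arg[OF assms, of ?e] E_spin_def by simp
  also have "\<dots> = s ^ CARD('d) * E_spin c\<^sub>0 c\<^sub>1 \<Phi>"
    using assms by (simp add: power2_eq_square)
  finally show ?thesis .
qed

lemma E_kin_dilate:
  fixes \<Phi> :: "'d::finite spinor"
  assumes "s > 0" and H1: "\<forall>l\<in>{-1..1}. \<Phi> l \<in> H1"
  shows "E_kin (\<lambda>l. dilate s (\<Phi> l)) = s\<^sup>2 * E_kin \<Phi>"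
proof -
  let ?e = "\<lambda>x. \<Sum>l\<in>{-1..1}. \<Sum>i\<in>UNIV. (cmod (weak_partial i (\<Phi> l) x))\<^sup>2"
  let ?e' = "\<lambda>x. \<Sum>l\<in>{-1..1}. \<Sum>i\<in>UNIV. (cmod (weak_partial i (dilate s (\<Phi> l)) x))\<^sup>2"
  have meas: "?e \<in> borel_measurable lebesgue" "?e' \<in> borel_measurable lebesgue"
    using H1_measurable(2)[OF H1[rule_format]] H1_measurable(2)[OF dilate_H1[OF \<open>s > 0\<close> H1[rule_format]]]
    by (auto intro!: borel_measurable_sum borel_measurable_power borel_measurable_norm)
  have "(LINT x|lebesgue. ?e' x) = (LINT x|lebesgue. s ^ CARD('d) * s\<^sup>2 * ?e (s *\<^sub>R x))"
  proof (rule integral_cong_AE)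
    show "(\<lambda>x. s ^ CARD('d) * s\<^sup>2 * ?e (s *\<^sub>R x)) \<in> borel_measurable lebesgue"
      using measurable_compose[OF lebesgue_measurable_scaling meas(1), of s] by simp
    show "AE x in lebesgue. ?e' x = s ^ CARD('d) * s\<^sup>2 * ?e (s *\<^sub>R x)"
      using AE_weak_partial_dilate[of s \<Phi>, OF \<open>s > 0\<close> H1]
      by eventually_elim
        (simp add: norm_mult power_mult_distrib cmod_dilate_square[OF \<open>s > 0\<close>] sum_distrib_left mult_ac)
  qed (rule meas)
  also have "\<dots> = s ^ CARD('d) * s\<^sup>2 * ((1 / s ^ CARD('d)) * (LINT x|lebesgue. ?e x))"
    unfolding integral_mult_right_zero integral_scaleR_arg[OF \<open>s > 0\<close>, of ?e] by simp
  finally show ?thesis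
    using \<open>s > 0\<close> by (simp add: E_kin_def)
qed

lemma E_rot_dilate:
  fixes \<Phi> :: "'d::{finite,numeral} spinor"
  assumes "s > 0" and H1: "\<forall>l\<in>{-1..1}. \<Phi> l \<in> H1"
  shows "E_rot \<Omega> (\<lambda>l. dilate s (\<Phi> l)) = E_rot \<Omega> \<Phi>"
proof -
  let ?e = "\<lambda>x. \<Sum>l\<in>{-1..1}. cnj (\<Phi> l x) * L_z (\<Phi> l) x"
  let ?e' = "\<lambda>x. \<Sum>l\<in>{-1..1}. cnj (dilate s (\<Phi> l) x) * L_z (dilate s (\<Phi> l)) x"
  have meas: "?e \<in> borel_measurable lebesgue" "?e' \<in> borel_measurable lebesgue"
    unfolding L_z_def
    using H1_measurable[OF H1[rule_format]] H1_measurable[OF dilate_H1[OF \<open>s > 0\<close> H1[rule_format]]]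
    by (auto intro!: borel_measurable_sum borel_measurable_times borel_measurable_diff borel_measurable_cnj
        borel_measurable_of_real_vec_nth)
  have "(LINT x|lebesgue. ?e' x) = (LINT x|lebesgue. s ^ CARD('d) * ?e (s *\<^sub>R x))"
  proof (rule integral_cong_AE)
    show "(\<lambda>x. s ^ CARD('d) * ?e (s *\<^sub>R x)) \<in> borel_measurable lebesgue"
      using measurable_compose[OF lebesgue_measurable_scaling meas(1), of s] by simp
    show "AE x in lebesgue. ?e' x = s ^ CARD('d) * ?e (s *\<^sub>R x)"
      using AE_weak_partial_dilate[of s \<Phi>, OF \<open>s > 0\<close> H1]
    proof eventually_elim
      case (elim x)
      have "cnj (dilate s (\<Phi> l) x) * L_z (dilate s (\<Phi> l)) x =
          s ^ CARD('d) * (cnj (\<Phi> l (s *\<^sub>R x)) * L_z (\<Phi> l) (s *\<^sub>R x))" if "l \<in> {-1..1}" for l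
      proof -
        have "L_z (dilate s (\<Phi> l)) x = dilate s (L_z (\<Phi> l)) x"
          using elim[rule_format, OF that] by (simp add: L_z_def dilate_def algebra_simps)
        then show ?thesis
          by (simp add: cnj_dilate_mult_dilate[OF \<open>s > 0\<close>])
      qed
      then show ?case by (simp add: sum_distrib_left)
    qed
  qed (rule meas)
  also have "\<dots> = s ^ CARD('d) * ((1 / s ^ CARD('d)) * (LINT x|lebesgue. ?e x))"
    unfolding integral_mult_right_zero integral_scaleR_arg[OF \<open>s > 0\<close>, of ?e]
    by (simp add: scaleR_conv_of_real)
  finally show ?thesis
    using \<open>s > 0\<close> by (simp add: E_rot_def)
qed

lemma E_soc_dilate:
  fixes \<Phi> :: "'d::{finite,numeral} spinor"
  assumes "s > 0" and H1: "\<forall>l\<in>{-1..1}. \<Phi> l \<in> H1"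
  shows "E_soc \<gamma> (\<lambda>l. dilate s (\<Phi> l)) = s * E_soc \<gamma> \<Phi>"
proof -
  let ?e = "soc_density \<Phi>"
  let ?e' = "soc_density (\<lambda>l. dilate s (\<Phi> l))"
  have meas: "?e \<in> borel_measurable lebesgue" "?e' \<in> borel_measurable lebesgue"
    unfolding soc_density_def[abs_def] L_0_def L_1_def
    using H1_measurable[OF H1[rule_format]] H1_measurable[OF dilate_H1[OF \<open>s > 0\<close> H1[rule_format]]]
    by (auto intro!: borel_measurable_add borel_measurable_times borel_measurable_diff borel_measurable_cnj)
  have "(LINT x|lebesgue. ?e' x) = (LINT x|lebesgue. s ^ CARD('d) * s * ?e (s *\<^sub>R x))"
  proof (rule integral_cong_AE)
    show "(\<lambda>x. s ^ CARD('d) * s * ?e (s *\<^sub>R x)) \<in> borel_measurable lebesgue"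
      using measurable_compose[OF lebesgue_measurable_scaling meas(1), of s] by simp
    show "AE x in lebesgue. ?e' x = s ^ CARD('d) * s * ?e (s *\<^sub>R x)"
      using AE_weak_partial_dilate[of s \<Phi>, OF \<open>s > 0\<close> H1]
    proof eventually_elim
      case (elim x)
      have L: "L_0 (dilate s (\<Phi> l)) x = s * dilate s (L_0 (\<Phi> l)) x"
        "L_1 (dilate s (\<Phi> l)) x = s * dilate s (L_1 (\<Phi> l)) x" if "l \<in> {-1..1}" for l
        using elim[rule_format, OF that] by (simp_all add: L_0_def L_1_def dilate_def algebra_simps)
      have *: "cnj (dilate s (\<Phi> j) x) * (s * dilate s f x) =
          s ^ CARD('d) * s * (cnj (\<Phi> j (s *\<^sub>R x)) * f (s *\<^sub>R x))" for j f
        using cnj_dilate_mult_dilate[OF \<open>s > 0\<close>, of "\<Phi> j" x f] by (simp add: mult_ac)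
      show ?case
        by (simp add: soc_density_def L distrib_left *)
    qed
  qed (rule meas)
  also have "\<dots> = s ^ CARD('d) * s * ((1 / s ^ CARD('d)) * (LINT x|lebesgue. ?e x))"
    unfolding integral_mult_right_zero integral_scaleR_arg[OF \<open>s > 0\<close>, of ?e]
    by (simp add: scaleR_conv_of_real)
  finally show ?thesis
    using \<open>s > 0\<close> by (simp add: E_soc_def)
qed

section \<open>The virial identity\<close>

lemma ground_state_virial:
  fixes \<Phi> :: "'d::{finite,numeral} spinor"
  assumes "ground_state (harmonic_potential \<omega>) c\<^sub>0 c\<^sub>1 \<Omega> \<gamma> \<Phi>"
  shows "2 * E_kin \<Phi> - 2 * E_pot (harmonic_potential \<omega>) \<Phi>
    + real CARD('d) * E_spin c\<^sub>0 c\<^sub>1 \<Phi> + E_soc \<gamma> \<Phi> = 0"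
proof -
  let ?V = "harmonic_potential \<omega>"
  have adm: "\<Phi> \<in> admissible ?V"
    and min: "\<And>\<Psi>. \<Psi> \<in> admissible ?V \<Longrightarrow> energy ?V c\<^sub>0 c\<^sub>1 \<Omega> \<gamma> \<Phi> \<le> energy ?V c\<^sub>0 c\<^sub>1 \<Omega> \<gamma> \<Psi>"
    using assms by (auto simp: ground_state_def)
  have H1: "\<forall>l\<in>{-1..1}. \<Phi> l \<in> H1"
    using adm by (simp add: admissible_def)
  define e where "e s = s\<^sup>2 * E_kin \<Phi> + E_pot ?V \<Phi> / s\<^sup>2 + s ^ CARD('d) * E_spin c\<^sub>0 c\<^sub>1 \<Phi>
    + E_rot \<Omega> \<Phi> + s * E_soc \<gamma> \<Phi>" for s
  have e: "energy ?V c\<^sub>0 c\<^sub>1 \<Omega> \<gamma> (\<lambda>l. dilate s (\<Phi> l)) = e s" if "s > 0" for s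
    using that H1 unfolding energy_def e_def
    by (simp only: E_kin_dilate E_pot_dilate E_spin_dilate E_rot_dilate E_soc_dilate)
  have "e 1 = energy ?V c\<^sub>0 c\<^sub>1 \<Omega> \<gamma> \<Phi>"
    by (simp add: e_def energy_def)
  then have le: "e 1 \<le> e s" if "s > 0" for s
    using min[OF dilate_admissible[OF that adm]] e[OF that] by simp
  have "(e has_real_derivative 2 * E_kin \<Phi> - 2 * E_pot ?V \<Phi>
      + real CARD('d) * E_spin c\<^sub>0 c\<^sub>1 \<Phi> + E_soc \<gamma> \<Phi>) (at 1)"
    unfolding e_def by (auto intro!: derivative_eq_intros)
  then show ?thesis
    by (rule DERIV_local_min[of _ _ _ 1]) (use le in auto)
qed

theorem theorem2:
  fixes c\<^sub>0 c\<^sub>1 \<Omega> \<gamma> :: real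
  shows
    "(\<forall>(\<omega> :: real ^ 2) (\<Phi> :: 2 spinor).
        (\<forall>i. \<omega> $ i > 0) \<and> ground_state (harmonic_potential \<omega>) c\<^sub>0 c\<^sub>1 \<Omega> \<gamma> \<Phi> \<longrightarrow>
        2 * E_kin \<Phi> - 2 * E_pot (harmonic_potential \<omega>) \<Phi> + 2 * E_spin c\<^sub>0 c\<^sub>1 \<Phi> + E_soc \<gamma> \<Phi> = 0) \<and>
     (\<forall>(\<omega> :: real ^ 3) (\<Phi> :: 3 spinor).
        (\<forall>i. \<omega> $ i > 0) \<and> ground_state (harmonic_potential \<omega>) c\<^sub>0 c\<^sub>1 \<Omega> \<gamma> \<Phi> \<longrightarrow>
        2 * E_kin \<Phi> - 2 * E_pot (harmonic_potential \<omega>) \<Phi> + 3 * E_spin c\<^sub>0 c\<^sub>1 \<Phi> + E_soc \<gamma> \<Phi> = 0)"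
  using ground_state_virial[where 'd = 2] ground_state_virial[where 'd = 3] by fastforce

end
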